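(* Let $M\in\mathbb{C}^{p\times p}$ be nonsingular, let $\mathcal{A}\in\mathbb{C}^{m\times m\times p}$ have tubal index $k$, and let $\mathcal{B}\in\mathbb{C}^{m\times 1\times p}$. The general solution $\mathcal{X}\in\mathbb{C}^{m\times 1\times p}$ of $$\mathcal{A}^{k+1}*_M\mathcal{X}=\mathcal{A}^k*_M\mathcal{B}$$ is $\mathcal{X}=\mathcal{A}^{\mathrm D}*_M\mathcal{B}+(\mathcal{I}-\mathcal{A}^{\mathrm D}*_M\mathcal{A})*_M\mathcal{Z}$, where $\mathcal{Z}\in\mathbb{C}^{m\times 1\times p}$ is arbitrary; that is, the set of solutions is exactly the set of tensors of this form.
   Context: Transform: for $\mathcal{A}\in\mathbb{C}^{m\times n\times p}$, $\tilde{\mathcal{A}}=\mathcal{A}\times_3 M\in\mathbb{C}^{m\times n\times p}$ is given by $(\tilde{\mathcal{A}})_{ijk}=\sum_{s=1}^p(\mathcal{A})_{ijs}M_{ks}$, and $\tilde{\mathcal{A}}^{(i)}=\tilde{\mathcal{A}}(:,:,i)$ is its $i$th frontal slice. Since $M$ is nonsingular, $\mathcal{A}\mapsto\tilde{\mathcal{A}}$ is a bijection. $M$-product: for $\mathcal{A}\in\mathbb{C}^{m\times n\times p}$, $\mathcal{B}\in\mathbb{C}^{n\times l\times p}$, $\mathcal{A}*_M\mathcal{B}$ is the unique $\mathcal{C}\in\mathbb{C}^{m\times l\times p}$ with $\tilde{\mathcal{C}}^{(i)}=\tilde{\mathcal{A}}^{(i)}\tilde{\mathcal{B}}^{(i)}$,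 $i=1,\dots,p$. The identity tensor $\mathcal{I}$ has $\tilde{\mathcal{I}}^{(i)}=I_m$ for all $i$; powers are taken with respect to $*_M$, with $\mathcal{A}^0=\mathcal{I}$. Tubal index of $\mathcal{A}\in\mathbb{C}^{m\times m\times p}$: $k=\max_{1\le i\le p}\mathrm{ind}(\tilde{\mathcal{A}}^{(i)})$, where $\mathrm{ind}(A)$ is the least integer $k\ge 0$ with $\mathrm{rank}(A^k)=\mathrm{rank}(A^{k+1})$. Drazin inverse: for $\mathcal{A}$ of tubal index $k$, $\mathcal{A}^{\mathrm D}$ is the unique $\mathcal{X}\in\mathbb{C}^{m\times m\times p}$ with $\mathcal{X}*_M\mathcal{A}*_M\mathcal{X}=\mathcal{X}$, $\mathcal{A}*_M\mathcal{X}=\mathcal{X}*_M\mathcal{A}$ and $\mathcal{X}*_M\mathcal{A}^{k+1}=\mathcal{A}^k$. *)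

theory Defs
  imports "HOL-Analysis.Analysis"
begin

text \<open>
  A tensor in \<open>C\<^sup>m\<^sup>\<times>\<^sup>n\<^sup>\<times>\<^sup>p\<close> is an element \<open>A\<close> of \<^typ>\<open>complex ^ 'p ^ 'n ^ 'm\<close>; its \<open>(i,j,k)\<close> entry
  is \<open>A $ i $ j $ k\<close>. Addition and subtraction of the type are the entrywise ones. The type's \<open>*\<close>,
  \<open>1\<close> and \<open>^\<close> are entrywise too, hence are used neither for matrices nor for tensors below.
\<close>

definition mode3_transform :: "complex ^ 'p ^ 'p \<Rightarrow> complex ^ 'p ^ 'n ^ 'm \<Rightarrow> complex ^ 'p ^ 'n ^ 'm" where
  "mode3_transform M A = (\<chi> i j k. \<Sum>s\<in>UNIV. A $ i $ j $ s * M $ k $ s)"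

definition frontal_slice :: "complex ^ 'p ^ 'n ^ 'm \<Rightarrow> 'p \<Rightarrow> complex ^ 'n ^ 'm" where
  "frontal_slice A k = (\<chi> i j. A $ i $ j $ k)"

text \<open>The descriptions below are uniquely satisfied when \<open>M\<close> is invertible; see the lemmas at the end
  for the transform, the product and the identity.\<close>

definition tensor_mult ::
    "complex ^ 'p ^ 'n ^ 'm \<Rightarrow> complex ^ 'p ^ 'p \<Rightarrow> complex ^ 'p ^ 'l ^ 'n \<Rightarrow> complex ^ 'p ^ 'l ^ 'm"
    (\<open>(_ \<star>\<^bsub>_\<^esub> _)\<close> [71, 0, 70] 70) where
  "A \<star>\<^bsub>M\<^esub> B = (THE C. \<forall>k. frontal_slice (mode3_transform M C) k =
      frontal_slice (mode3_transform M A) k ** frontal_slice (mode3_transform M B) k)"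

definition tensor_id :: "complex ^ 'p ^ 'p \<Rightarrow> complex ^ 'p ^ 'm ^ 'm" where
  "tensor_id M = (THE I. \<forall>k. frontal_slice (mode3_transform M I) k = mat 1)"

primrec tensor_power :: "complex ^ 'p ^ 'p \<Rightarrow> complex ^ 'p ^ 'm ^ 'm \<Rightarrow> nat \<Rightarrow> complex ^ 'p ^ 'm ^ 'm" where
  "tensor_power M A 0 = tensor_id M"
| "tensor_power M A (Suc n) = A \<star>\<^bsub>M\<^esub> tensor_power M A n"

primrec matrix_power :: "complex ^ 'm ^ 'm \<Rightarrow> nat \<Rightarrow> complex ^ 'm ^ 'm" where
  "matrix_power A 0 = mat 1"
| "matrix_power A (Suc n) = A ** matrix_power A n"

definition matrix_index :: "complex ^ 'm ^ 'm \<Rightarrow> nat" where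
  "matrix_index A = (LEAST k. rank (matrix_power A k) = rank (matrix_power A (k + 1)))"

definition tubal_index :: "complex ^ 'p ^ 'p \<Rightarrow> complex ^ 'p ^ 'm ^ 'm \<Rightarrow> nat" where
  "tubal_index M A = Max (range (\<lambda>i. matrix_index (frontal_slice (mode3_transform M A) i)))"

definition drazin_inverse :: "complex ^ 'p ^ 'p \<Rightarrow> complex ^ 'p ^ 'm ^ 'm \<Rightarrow> complex ^ 'p ^ 'm ^ 'm" where
  "drazin_inverse M A = (THE X.
      X \<star>\<^bsub>M\<^esub> A \<star>\<^bsub>M\<^esub> X = X \<and>
      A \<star>\<^bsub>M\<^esub> X = X \<star>\<^bsub>M\<^esub> A \<and>
      X \<star>\<^bsub>M\<^esub> tensor_power M A (tubal_index M A + 1) = tensor_power M A (tubal_index M A))"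

lemma mode3_transform_nth: "mode3_transform M A $ i $ j = M *v (A $ i $ j)"
  by (simp add: mode3_transform_def matrix_vector_mult_def vec_eq_iff mult.commute)

lemma ex1_tensor_slices:
  fixes M :: "complex ^ 'p ^ 'p" and S :: "'p \<Rightarrow> complex ^ 'n ^ 'm"
  assumes "invertible M"
  shows "\<exists>!C. \<forall>k. frontal_slice (mode3_transform M C) k = S k"
proof -
  obtain N where N: "M ** N = mat 1" "N ** M = mat 1"
    using assms unfolding invertible_def by blast
  have slices: "(\<forall>k. frontal_slice (mode3_transform M C) k = S k) \<longleftrightarrow>
      (\<forall>i j. M *v (C $ i $ j) = (\<chi> k. S k $ i $ j))" for C
    by (auto simp: frontal_slice_def vec_eq_iff mode3_transform_nth)
  have solve: "M *v x = y \<longleftrightarrow> x = N *v y" for x y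
    using N by (metis matrix_vector_mul_assoc matrix_vector_mul_lid)
  show ?thesis
    unfolding slices solve
    by (rule ex1I[of _ "\<chi> i j. N *v (\<chi> k. S k $ i $ j)"]) (simp_all add: vec_eq_iff)
qed

lemma slice_tensor_mult:
  assumes "invertible M"
  shows "frontal_slice (mode3_transform M (A \<star>\<^bsub>M\<^esub> B)) k =
    frontal_slice (mode3_transform M A) k ** frontal_slice (mode3_transform M B) k"
  using theI'[OF ex1_tensor_slices[OF assms,
        of "\<lambda>k. frontal_slice (mode3_transform M A) k ** frontal_slice (mode3_transform M B) k"]]
  unfolding tensor_mult_def by blast

lemma slice_tensor_id:
  assumes "invertible M"
  shows "frontal_slice (mode3_transform M (tensor_id M)) k = mat 1"
  using theI'[OF ex1_tensor_slices[OF assms, of "\<lambda>_. mat 1"]]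
  unfolding tensor_id_def by blast

end

theory Submission
  imports Defs
begin

text \<open>
  The Drazin inverse \<open>D\<close> of \<open>A\<close> satisfies \<open>D = D\<^sup>k\<^sup>+\<^sup>1 A\<^sup>k\<close>, since \<open>D = D A D = D\<^sup>2 A\<close> can be iterated.
  If \<open>A\<^sup>k\<^sup>+\<^sup>1 X = A\<^sup>k B\<close>, multiplying by \<open>D\<^sup>k\<^sup>+\<^sup>1\<close> therefore turns the equation into \<open>D A X = D B\<close>, so
  \<open>X = D B + (I - D A) X\<close> has the required form with \<open>Z = X\<close>. Conversely \<open>A\<^sup>k\<^sup>+\<^sup>1 D = A\<^sup>k\<close> shows that
  \<open>A\<^sup>k\<^sup>+\<^sup>1\<close> maps \<open>D B\<close> to \<open>A\<^sup>k B\<close> and annihilates \<open>I - D A\<close>.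

  All of this rests on the three Drazin equations, which the definite description defining \<open>D\<close>
  yields only once existence and uniqueness are known. Both hold in any monoid for an element with
  \<open>a\<^sup>k = a\<^sup>k\<^sup>+\<^sup>1 y = z a\<^sup>k\<^sup>+\<^sup>1\<close> (\<open>ex1_drazin\<close>): the inverse is \<open>a\<^sup>k y\<^sup>k\<^sup>+\<^sup>1 = z\<^sup>k\<^sup>+\<^sup>1 a\<^sup>k\<close>. For a complex matrix
  the factors \<open>y\<close> and \<open>z\<close> come from the rank condition in the definition of the index. Equality of
  the ranks of \<open>A\<^sup>k\<close> and \<open>A\<^sup>k\<^sup>+\<^sup>1\<close> means equality of their row spaces, which gives \<open>z\<close>; hence \<open>A\<close> is
  injective on the range of \<open>A\<^sup>k\<close>, so it maps this finite-dimensional space onto itself, which gives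
  \<open>y\<close>. A tensor of tubal index \<open>k\<close> receives its factors from those of its transformed slices.
\<close>

section \<open>Drazin inverses in monoids\<close>

context monoid_mult
begin

lemma iterate_right_factor:
  assumes "a ^ k = a ^ (k + 1) * y"
  shows "a ^ (k + n) * y ^ n = a ^ k"
proof (induction n)
  case (Suc n)
  have "a ^ (k + Suc n) = a ^ n * a ^ (k + 1)"
    by (subst power_add[symmetric]) (simp add: add.commute)
  then have "a ^ (k + Suc n) * y ^ Suc n = a ^ n * (a ^ (k + 1) * y) * y ^ n"
    by (simp only: mult.assoc power_Suc)
  also have "\<dots> = a ^ (k + n) * y ^ n"
    unfolding assms[symmetric] by (simp add: power_add[symmetric] add.commute)
  finally show ?case
    using Suc by simp
qed simp

lemma iterate_left_factor:
  assumes "a ^ k = z * a ^ (k + 1)"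
  shows "z ^ n * a ^ (k + n) = a ^ k"
proof (induction n)
  case (Suc n)
  have "a ^ (k + Suc n) = a ^ (k + 1) * a ^ n"
    by (subst power_add[symmetric]) simp
  then have "z ^ Suc n * a ^ (k + Suc n) = z ^ n * (z * a ^ (k + 1)) * a ^ n"
    by (simp only: mult.assoc power_Suc2)
  also have "\<dots> = z ^ n * a ^ (k + n)"
    unfolding assms[symmetric] by (simp add: mult.assoc power_add[symmetric])
  finally show ?case
    using Suc by simp
qed simp

text \<open>The equation \<open>x = x a x = x\<^sup>2 a\<close>, iterated.\<close>

lemma outer_inverse_eq_power_mult:
  assumes "x * (a * x) = x" and "a * x = x * a"
  shows "x ^ (n + 1) * a ^ n = x"
proof (induction n)
  case (Suc n)
  have "x ^ (Suc n + 1) * a ^ Suc n = x * (x ^ (n + 1) * a ^ n) * a"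
    unfolding add_Suc power_Suc[of x] power_Suc2[of a] mult.assoc ..
  also have "\<dots> = x"
    using Suc assms by (simp add: mult.assoc)
  finally show ?case .
qed simp

text \<open>
  The witness \<open>x = a\<^sup>k y\<^sup>k\<^sup>+\<^sup>1\<close> also equals \<open>z\<^sup>k\<^sup>+\<^sup>1 a\<^sup>k\<close>, because both expressions equal
  \<open>z\<^sup>k\<^sup>+\<^sup>1 a\<^sup>2\<^sup>k\<^sup>+\<^sup>1 y\<^sup>k\<^sup>+\<^sup>1\<close>; having both forms makes \<open>x\<close> commute with \<open>a\<close>. Two Drazin inverses
  \<open>x\<close> and \<open>x'\<close> agree because both equal \<open>x a x'\<close>.
\<close>

lemma ex1_drazin:
  assumes y: "a ^ k = a ^ (k + 1) * y" and z: "a ^ k = z * a ^ (k + 1)"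
  shows "\<exists>!x. x * (a * x) = x \<and> a * x = x * a \<and> x * a ^ (k + 1) = a ^ k"
proof (rule ex_ex1I)
  define x where "x = a ^ k * y ^ (k + 1)"
  have ay: "a ^ (k + (k + 1)) * y ^ (k + 1) = a ^ k"
    by (rule iterate_right_factor[OF y])
  have za: "z ^ (k + 1) * a ^ (k + (k + 1)) = a ^ k"
    by (rule iterate_left_factor[OF z])
  have x_left: "x = z ^ (k + 1) * a ^ k"
    by (metis x_def ay za mult.assoc)
  have "x * a = z ^ (k + 1) * a ^ (k + 1)"
    by (simp add: x_left mult.assoc power_Suc2 del: power_Suc)
  also have "\<dots> = z ^ (k + 1) * (a * (a ^ (k + (k + 1)) * y ^ (k + 1)))"
    unfolding ay by simp
  also have "\<dots> = (z ^ (k + 1) * a ^ (k + (k + 1))) * (a * y ^ (k + 1))"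
    by (metis mult.assoc power_commutes)
  also have "\<dots> = a * x"
    unfolding za x_def by (metis mult.assoc power_commutes)
  finally have comm: "a * x = x * a" ..
  have inv: "x * a ^ (k + 1) = a ^ k"
    using za unfolding x_left power_add[of a k "k + 1"] mult.assoc .
  have "x * (a * x) = x * a ^ (k + 1) * y ^ (k + 1)"
    by (simp add: x_def mult.assoc)
  then have "x * (a * x) = x"
    unfolding inv x_def[symmetric] .
  with comm inv show "\<exists>x. x * (a * x) = x \<and> a * x = x * a \<and> x * a ^ (k + 1) = a ^ k"
    by blast
next
  fix x x'
  assume x: "x * (a * x) = x \<and> a * x = x * a \<and> x * a ^ (k + 1) = a ^ k"
    and x': "x' * (a * x') = x' \<and> a * x' = x' * a \<and> x' * a ^ (k + 1) = a ^ k"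
  have powers_commute: "w ^ n * a ^ l = a ^ l * w ^ n" if "a * w = w * a" for w n l
    using that by (metis power_commuting_commutes)
  have x_eq: "x ^ (k + 1) * a ^ k = x"
    using x by (metis outer_inverse_eq_power_mult)
  have x'_eq: "a ^ k * x' ^ (k + 1) = x'"
    using x' by (metis outer_inverse_eq_power_mult powers_commute)
  have "x = x ^ (k + 1) * a ^ k"
    by (rule x_eq[symmetric])
  also have "a ^ k = a ^ (k + 1) * x'"
    using x' powers_commute[of x' 1 "k + 1"] by (metis power_one_right)
  also have "x ^ (k + 1) * (a ^ (k + 1) * x') = x ^ (k + 1) * a ^ k * (a * x')"
    by (simp only: mult.assoc power_Suc2 Suc_eq_plus1[symmetric])
  also have "\<dots> = x * (a * x')"
    unfolding x_eq ..
  finally have "x = x * (a * x')" .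
  moreover have "x' = x * (a * x')"
  proof -
    have "x' = x * a ^ (k + 1) * x' ^ (k + 1)"
      using x x'_eq by simp
    also have "\<dots> = x * (a * (a ^ k * x' ^ (k + 1)))"
      by (simp add: mult.assoc)
    finally show ?thesis
      unfolding x'_eq .
  qed
  ultimately show "x = x'" by simp
qed

end

section \<open>Stabilisation of matrix powers\<close>

lemma row_matrix_matrix_mult: "row i (A ** B) = row i A v* B"
  by (simp add: row_def matrix_matrix_mult_def vector_matrix_mult_def vec_eq_iff mult.commute)

lemma span_rows_eq_range:
  fixes A :: "'a::field ^ 'n ^ 'm"
  shows "vec.span (rows A) = range (\<lambda>v. v v* A)"
proof
  have "vec.subspace (range ((*v) (transpose A)))"
    by (intro vec.linear_subspace_image vec.subspace_UNIV matrix_vector_mul_linear_gen)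
  moreover have "rows A \<subseteq> range (\<lambda>v. v v* A)"
    unfolding rows_def by clarsimp (metis matrix_mul_lid range_eqI row_matrix_matrix_mult)
  ultimately show "vec.span (rows A) \<subseteq> range (\<lambda>v. v v* A)"
    by (intro vec.span_minimal) simp_all
  show "range (\<lambda>v. v v* A) \<subseteq> vec.span (rows A)"
    using matrix_vector_mult_in_columnspace_gen[of "transpose A"] by auto
qed

lemma rows_mult_subset_span_rows:
  fixes A :: "'a::field ^ 'n ^ 'm"
  shows "rows (C ** A) \<subseteq> vec.span (rows A)"
  unfolding span_rows_eq_range by (auto simp: rows_def row_matrix_matrix_mult)

lemma rank_mult_le_right_field:
  fixes A :: "'a::field ^ 'n ^ 'm"
  shows "rank (C ** A) \<le> rank A"
  unfolding row_rank_def_gen by (rule vec.dim_mono[OF rows_mult_subset_span_rows])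

text \<open>
  The rows of \<open>C A\<close> lie in the row space of \<open>A\<close>; equal ranks make the two row spaces coincide, and
  the coefficients expressing the rows of \<open>A\<close> through those of \<open>C A\<close> are the rows of \<open>Z\<close>.
\<close>

lemma left_factor_of_rank_eq:
  fixes A :: "'a::field ^ 'n ^ 'm" and C :: "'a ^ 'm ^ 'l"
  assumes "rank (C ** A) = rank A"
  obtains Z where "A = Z ** (C ** A)"
proof -
  have "vec.span (rows (C ** A)) = vec.span (rows A)"
    using assms rows_mult_subset_span_rows[of C A]
    by (intro vec.subspace_dim_equal) (auto simp: row_rank_def_gen vec.span_minimal)
  then have "row i A \<in> range (\<lambda>v. v v* (C ** A))" for i
    unfolding span_rows_eq_range[symmetric] by (auto simp: rows_def intro: vec.span_base)
  then have "\<forall>i. \<exists>v. row i A = v v* (C ** A)"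
    by blast
  then obtain f where f: "row i A = f i v* (C ** A)" for i
    by (rule choice[THEN exE]) blast
  have "A = (\<chi> i. f i) ** (C ** A)"
  proof -
    have "row i A = row i ((\<chi> i. f i) ** (C ** A))" for i
      unfolding row_matrix_matrix_mult[of i "\<chi> i. f i"] f by (simp add: row_def)
    then show ?thesis
      by (simp add: row_def vec_eq_iff)
  qed
  then show thesis ..
qed

lemma column_matrix_vector_mult:
  fixes A :: "'a::field ^ 'n ^ 'm"
  shows "column j A = A *v axis j 1"
  by (simp add: column_def matrix_vector_mult_def axis_def vec_eq_iff if_distrib cong: if_cong)

text \<open>
  A left factor of \<open>C\<close> through \<open>A C\<close> makes \<open>A\<close> injective on the range of \<open>C\<close>; commutation makes
  that range invariant, so by finite dimension \<open>A\<close> maps it onto itself.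
\<close>

lemma right_factor_of_left_factor:
  fixes A C Z :: "'a::field ^ 'n ^ 'n"
  assumes Z: "C = Z ** (A ** C)" and comm: "A ** C = C ** A"
  obtains Y where "C = A ** C ** Y"
proof -
  let ?R = "range ((*v) C)"
  have sub: "vec.subspace ?R"
    by (intro vec.linear_subspace_image vec.subspace_UNIV matrix_vector_mul_linear_gen)
  have Z': "Z *v (A *v v) = v" if "v \<in> ?R" for v
    using that by (metis Z matrix_vector_mul_assoc rangeE)
  then have "inj_on ((*v) A) (vec.span ?R)"
    using sub by (metis inj_on_def vec.span_eq_iff)
  then have "vec.dim ((*v) A ` ?R) = vec.dim ?R"
    by (intro vec.dim_image_eq matrix_vector_mul_linear_gen)
  moreover have "(*v) A ` ?R \<subseteq> ?R"
    by (auto simp: matrix_vector_mul_assoc comm) (metis matrix_vector_mul_assoc rangeI)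
  moreover have "vec.subspace ((*v) A ` ?R)"
    by (intro vec.linear_subspace_image sub matrix_vector_mul_linear_gen)
  ultimately have onto: "(*v) A ` ?R = ?R"
    using sub by (intro vec.subspace_dim_equal) auto
  have "\<exists>w. column j C = (A ** C) *v w" for j
  proof -
    have "column j C \<in> ?R"
      by (metis column_matrix_vector_mult rangeI)
    then have "column j C \<in> (*v) A ` ?R"
      by (simp only: onto)
    then show ?thesis
      by (auto simp: matrix_vector_mul_assoc)
  qed
  then obtain g where g: "column j C = (A ** C) *v g j" for j
    by metis
  have "C = A ** C ** (\<chi> i j. g j $ i)"
  proof -
    have "C $ i $ j = (A ** C ** (\<chi> i j. g j $ i)) $ i $ j" for i j
    proof -
      have "C $ i $ j = column j C $ i"
        by (simp add: column_def)
      then show ?thesis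
        unfolding g by (simp add: matrix_matrix_mult_def[of "A ** C"] matrix_vector_mult_def)
    qed
    then show ?thesis
      by (simp add: vec_eq_iff)
  qed
  then show thesis ..
qed

lemma matrix_power_commute: "A ** matrix_power A n = matrix_power A n ** A"
  by (induction n) (simp_all, metis matrix_mul_assoc)

lemma matrix_power_add: "matrix_power A (m + n) = matrix_power A m ** matrix_power A n"
  by (induction m) (simp_all add: matrix_mul_assoc)

text \<open>
  Ranks of powers cannot strictly decrease forever, so the minimum in the definition of the index
  is attained.
\<close>

lemma rank_matrix_power_index:
  "rank (matrix_power A (matrix_index A)) = rank (matrix_power A (matrix_index A + 1))"
  unfolding matrix_index_def
proof (rule LeastI_ex, rule ccontr)
  assume "\<nexists>k. rank (matrix_power A k) = rank (matrix_power A (k + 1))"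
  then have "rank (matrix_power A (Suc k)) < rank (matrix_power A k)" for k
    using rank_mult_le_right_field[of A "matrix_power A k"]
    by (metis Suc_eq_plus1 le_neq_implies_less matrix_power.simps(2))
  then show False
    using wf_iff_no_infinite_down_chain[THEN iffD1, OF wf_less]
    by (auto dest!: spec[where x = "\<lambda>k. rank (matrix_power A k)"])
qed

text \<open>
  The factors found at the index itself serve every larger exponent, because the extra power of
  \<open>A\<close> can be multiplied on from either side. This matters because the tubal index may exceed the
  index of an individual slice.
\<close>

lemma matrix_power_factors:
  assumes "matrix_index A \<le> k"
  obtains Y Z where "matrix_power A k = matrix_power A (k + 1) ** Y"
    and "matrix_power A k = Z ** matrix_power A (k + 1)"
proof -
  let ?C = "matrix_power A (matrix_index A)"
  have "rank (A ** ?C) = rank ?C"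
    using rank_matrix_power_index[of A] by simp
  then obtain Z where Z: "?C = Z ** (A ** ?C)"
    by (rule left_factor_of_rank_eq)
  obtain Y where Y: "?C = A ** ?C ** Y"
    using right_factor_of_left_factor[OF Z matrix_power_commute] .
  obtain d where d: "k = d + matrix_index A"
    using assms by (metis le_add_diff_inverse2)
  have k: "matrix_power A k = matrix_power A d ** ?C"
    "matrix_power A k = ?C ** matrix_power A d"
    using matrix_power_add[of A d "matrix_index A"] matrix_power_add[of A "matrix_index A" d]
    by (simp_all only: d add.commute)
  have "matrix_power A k = matrix_power A (k + 1) ** Y"
  proof -
    have "matrix_power A k = matrix_power A d ** (A ** ?C ** Y)"
      using k(1) Y by simp
    also have "\<dots> = A ** (matrix_power A d ** ?C) ** Y"
      by (simp only: matrix_mul_assoc matrix_power_commute[of A d])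
    finally show ?thesis
      by (simp add: k(1)[symmetric])
  qed
  moreover have "matrix_power A k = Z ** matrix_power A (k + 1)"
  proof -
    have "matrix_power A k = Z ** (A ** ?C) ** matrix_power A d"
      using k(2) Z by simp
    also have "\<dots> = Z ** (A ** (?C ** matrix_power A d))"
      by (simp only: matrix_mul_assoc)
    finally show ?thesis
      by (simp add: k(2)[symmetric])
  qed
  ultimately show thesis ..
qed

section \<open>Algebra of the M-product\<close>

context
  fixes M :: "complex ^ 'p ^ 'p"
  assumes M: "invertible M"
begin

lemma tensor_eqI:
  assumes "\<And>k. frontal_slice (mode3_transform M X) k = frontal_slice (mode3_transform M Y) k"
  shows "X = Y"
  using ex1_tensor_slices[OF M, of "frontal_slice (mode3_transform M Y)"] assms by blast

lemma ex_tensor_slices: "\<exists>X. \<forall>k. frontal_slice (mode3_transform M X) k = S k"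
  using ex1_tensor_slices[OF M] by blast

lemma slice_add:
  "frontal_slice (mode3_transform M (X + Y)) k =
    frontal_slice (mode3_transform M X) k + frontal_slice (mode3_transform M Y) k"
  by (simp add: frontal_slice_def mode3_transform_nth vec_eq_iff matrix_vector_right_distrib)

lemma slice_diff:
  "frontal_slice (mode3_transform M (X - Y)) k =
    frontal_slice (mode3_transform M X) k - frontal_slice (mode3_transform M Y) k"
  by (simp add: frontal_slice_def mode3_transform_nth vec_eq_iff matrix_vector_mult_diff_distrib)

lemma slice_tensor_power:
  "frontal_slice (mode3_transform M (tensor_power M X n)) k =
    matrix_power (frontal_slice (mode3_transform M X) k) n"
  by (induction n) (simp_all add: slice_tensor_id[OF M] slice_tensor_mult[OF M])

lemma tensor_mult_assoc: "(X \<star>\<^bsub>M\<^esub> Y) \<star>\<^bsub>M\<^esub> Z = X \<star>\<^bsub>M\<^esub> (Y \<star>\<^bsub>M\<^esub> Z)"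
  by (rule tensor_eqI) (simp add: slice_tensor_mult[OF M] matrix_mul_assoc)

lemma tensor_id_left: "tensor_id M \<star>\<^bsub>M\<^esub> X = X"
  by (rule tensor_eqI) (simp add: slice_tensor_mult[OF M] slice_tensor_id[OF M])

lemma tensor_id_right: "X \<star>\<^bsub>M\<^esub> tensor_id M = X"
  by (rule tensor_eqI) (simp add: slice_tensor_mult[OF M] slice_tensor_id[OF M])

lemma tensor_mult_add_right: "X \<star>\<^bsub>M\<^esub> (Y + Z) = X \<star>\<^bsub>M\<^esub> Y + X \<star>\<^bsub>M\<^esub> Z"
  by (rule tensor_eqI) (simp add: slice_tensor_mult[OF M] slice_add matrix_add_ldistrib)

lemma tensor_mult_diff_left: "(X - Y) \<star>\<^bsub>M\<^esub> Z = X \<star>\<^bsub>M\<^esub> Z - Y \<star>\<^bsub>M\<^esub> Z"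
  by (rule tensor_eqI)
     (simp add: slice_tensor_mult[OF M] slice_diff matrix_matrix_mult_def vec_eq_iff
       left_diff_distrib sum_subtractf)

lemma tensor_mult_diff_right: "X \<star>\<^bsub>M\<^esub> (Y - Z) = X \<star>\<^bsub>M\<^esub> Y - X \<star>\<^bsub>M\<^esub> Z"
  by (rule tensor_eqI)
     (simp add: slice_tensor_mult[OF M] slice_diff matrix_matrix_mult_def vec_eq_iff
       right_diff_distrib sum_subtractf)

text \<open>
  The type's own \<open>*\<close> and \<open>^\<close> are entrywise, so the monoid lemmas reach tensors through the locale
  predicate rather than through a class instance.
\<close>

lemma monoid_tensor_mult: "class.monoid_mult (tensor_id M) (\<lambda>X Y. X \<star>\<^bsub>M\<^esub> Y)"
  by unfold_locales (simp_all add: tensor_mult_assoc tensor_id_left tensor_id_right)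

lemma tensor_power_eq_monoid_power:
  "tensor_power M A n = power.power (tensor_id M) (\<lambda>X Y. X \<star>\<^bsub>M\<^esub> Y) A n"
  by (induction n) (simp_all add: power.power.simps)

section \<open>The Drazin inverse of a tensor\<close>

lemma tensor_power_factors:
  fixes A :: "complex ^ 'p ^ 'm ^ 'm"
  assumes "tubal_index M A = k"
  obtains Y Z where "tensor_power M A k = tensor_power M A (k + 1) \<star>\<^bsub>M\<^esub> Y"
    and "tensor_power M A k = Z \<star>\<^bsub>M\<^esub> tensor_power M A (k + 1)"
proof -
  let ?S = "frontal_slice (mode3_transform M A)"
  have "matrix_index (?S i) \<le> k" for i
    unfolding assms[symmetric] tubal_index_def by (rule Max_ge) auto
  then have "\<exists>Y Z. matrix_power (?S i) k = matrix_power (?S i) (k + 1) ** Y \<and>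
      matrix_power (?S i) k = Z ** matrix_power (?S i) (k + 1)" for i
    by (metis matrix_power_factors)
  then obtain f g
    where f: "matrix_power (?S i) k = matrix_power (?S i) (k + 1) ** f i"
      and g: "matrix_power (?S i) k = g i ** matrix_power (?S i) (k + 1)" for i
    by metis
  obtain Y where Y: "frontal_slice (mode3_transform M Y) i = f i" for i
    using ex_tensor_slices[of f] by blast
  obtain Z where Z: "frontal_slice (mode3_transform M Z) i = g i" for i
    using ex_tensor_slices[of g] by blast
  have "tensor_power M A k = tensor_power M A (k + 1) \<star>\<^bsub>M\<^esub> Y"
    by (rule tensor_eqI) (simp only: slice_tensor_mult[OF M] slice_tensor_power Y f[symmetric])
  moreover have "tensor_power M A k = Z \<star>\<^bsub>M\<^esub> tensor_power M A (k + 1)"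
    by (rule tensor_eqI) (simp only: slice_tensor_mult[OF M] slice_tensor_power Z g[symmetric])
  ultimately show thesis ..
qed

lemma drazin_inverse_equations:
  fixes A :: "complex ^ 'p ^ 'm ^ 'm"
  defines "D \<equiv> drazin_inverse M A" and "k \<equiv> tubal_index M A"
  shows "D \<star>\<^bsub>M\<^esub> A \<star>\<^bsub>M\<^esub> D = D" "A \<star>\<^bsub>M\<^esub> D = D \<star>\<^bsub>M\<^esub> A"
    "D \<star>\<^bsub>M\<^esub> tensor_power M A (k + 1) = tensor_power M A k"
proof -
  have "tubal_index M A = k"
    by (simp add: k_def)
  then obtain Y Z where "tensor_power M A k = tensor_power M A (k + 1) \<star>\<^bsub>M\<^esub> Y"
    "tensor_power M A k = Z \<star>\<^bsub>M\<^esub> tensor_power M A (k + 1)"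
    by (rule tensor_power_factors)
  then have "\<exists>!X. X \<star>\<^bsub>M\<^esub> A \<star>\<^bsub>M\<^esub> X = X \<and> A \<star>\<^bsub>M\<^esub> X = X \<star>\<^bsub>M\<^esub> A \<and>
      X \<star>\<^bsub>M\<^esub> tensor_power M A (k + 1) = tensor_power M A k"
    unfolding tensor_power_eq_monoid_power by (rule monoid_mult.ex1_drazin[OF monoid_tensor_mult])
  from theI'[OF this]
  show "D \<star>\<^bsub>M\<^esub> A \<star>\<^bsub>M\<^esub> D = D" "A \<star>\<^bsub>M\<^esub> D = D \<star>\<^bsub>M\<^esub> A"
    "D \<star>\<^bsub>M\<^esub> tensor_power M A (k + 1) = tensor_power M A k"
    unfolding D_def drazin_inverse_def k_def by blast+
qed

lemma tensor_power_mult_drazin: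
  "tensor_power M A (tubal_index M A + 1) \<star>\<^bsub>M\<^esub> drazin_inverse M A =
    tensor_power M A (tubal_index M A)"
  unfolding drazin_inverse_equations(3)[of A, symmetric]
  unfolding tensor_power_eq_monoid_power
  by (rule monoid_mult.power_commuting_commutes[OF monoid_tensor_mult drazin_inverse_equations(2)])

lemma drazin_eq_power_mult:
  "tensor_power M (drazin_inverse M A) (n + 1) \<star>\<^bsub>M\<^esub> tensor_power M A n = drazin_inverse M A"
  unfolding tensor_power_eq_monoid_power
  by (rule monoid_mult.outer_inverse_eq_power_mult[OF monoid_tensor_mult
        drazin_inverse_equations(1,2)])

lemma tensor_power_Suc_right: "tensor_power M A (n + 1) = tensor_power M A n \<star>\<^bsub>M\<^esub> A"
  using monoid_mult.power_Suc2[OF monoid_tensor_mult, of A n]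
  unfolding tensor_power_eq_monoid_power by simp

end

theorem theorem6p3:
  fixes M :: "complex ^ 'p ^ 'p"
    and A :: "complex ^ 'p ^ 'm ^ 'm"
    and B :: "complex ^ 'p ^ 1 ^ 'm"
    and k :: nat
  assumes "invertible M"
    and "tubal_index M A = k"
  shows "{X :: complex ^ 'p ^ 1 ^ 'm.
            tensor_power M A (k + 1) \<star>\<^bsub>M\<^esub> X = tensor_power M A k \<star>\<^bsub>M\<^esub> B} =
         {drazin_inverse M A \<star>\<^bsub>M\<^esub> B + (tensor_id M - drazin_inverse M A \<star>\<^bsub>M\<^esub> A) \<star>\<^bsub>M\<^esub> Z
            | Z :: complex ^ 'p ^ 1 ^ 'm. True}"
proof -
  note M = assms(1)
  let ?D = "drazin_inverse M A" and ?P = "tensor_power M A"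
  have PD: "?P (k + 1) \<star>\<^bsub>M\<^esub> ?D = ?P k"
    using tensor_power_mult_drazin[OF M, of A] assms(2) by simp
  have solves: "?P (k + 1) \<star>\<^bsub>M\<^esub> (?D \<star>\<^bsub>M\<^esub> B + (tensor_id M - ?D \<star>\<^bsub>M\<^esub> A) \<star>\<^bsub>M\<^esub> Z) = ?P k \<star>\<^bsub>M\<^esub> B"
    for Z :: "complex ^ 'p ^ 1 ^ 'm"
  proof -
    have "?P (k + 1) \<star>\<^bsub>M\<^esub> (tensor_id M - ?D \<star>\<^bsub>M\<^esub> A) = ?P (k + 1) - (?P (k + 1) \<star>\<^bsub>M\<^esub> ?D) \<star>\<^bsub>M\<^esub> A"
      by (simp only: tensor_mult_diff_right[OF M] tensor_id_right[OF M] tensor_mult_assoc[OF M])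
    also have "\<dots> = 0"
      by (simp only: PD tensor_power_Suc_right[OF M, symmetric] diff_self)
    finally have annihilates: "?P (k + 1) \<star>\<^bsub>M\<^esub> (tensor_id M - ?D \<star>\<^bsub>M\<^esub> A) = 0" .
    have "(0 :: complex ^ 'p ^ 'm ^ 'm) \<star>\<^bsub>M\<^esub> Z = 0"
      using tensor_mult_diff_left[OF M, of 0 0 Z] by simp
    then show ?thesis
      unfolding tensor_mult_add_right[OF M] tensor_mult_assoc[OF M, symmetric] annihilates PD
      by simp
  qed
  have form: "X = ?D \<star>\<^bsub>M\<^esub> B + (tensor_id M - ?D \<star>\<^bsub>M\<^esub> A) \<star>\<^bsub>M\<^esub> X"
    if X: "?P (k + 1) \<star>\<^bsub>M\<^esub> X = ?P k \<star>\<^bsub>M\<^esub> B" for X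
  proof -
    let ?E = "tensor_power M ?D (k + 1)"
    have D: "?E \<star>\<^bsub>M\<^esub> ?P k = ?D"
      by (rule drazin_eq_power_mult[OF M])
    have "?D \<star>\<^bsub>M\<^esub> A = ?E \<star>\<^bsub>M\<^esub> ?P (k + 1)"
      unfolding tensor_power_Suc_right[OF M, of A] tensor_mult_assoc[OF M, symmetric] D ..
    then have "(?D \<star>\<^bsub>M\<^esub> A) \<star>\<^bsub>M\<^esub> X = ?E \<star>\<^bsub>M\<^esub> ?P k \<star>\<^bsub>M\<^esub> B"
      by (simp only: tensor_mult_assoc[OF M] X)
    then have "(?D \<star>\<^bsub>M\<^esub> A) \<star>\<^bsub>M\<^esub> X = ?D \<star>\<^bsub>M\<^esub> B"
      by (simp only: tensor_mult_assoc[OF M, symmetric] D)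
    then show ?thesis
      by (simp add: tensor_mult_diff_left[OF M] tensor_id_left[OF M])
  qed
  show ?thesis
    using solves form by blast
qed

end
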